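(* Let $\mathbb{X}$ and $\mathbb{Y}$ be real Hilbert spaces with a continuous and compact linear embedding $\gamma:\mathbb{X}\to\mathbb{Y}$. Let $M$ be a symmetric, continuous and coercive bilinear form on $\mathbb{X}\times\mathbb{X}$, and let $N$ be a symmetric, continuous and positive semi-definite bilinear form on $\mathbb{Y}\times\mathbb{Y}$. Let $\mathbb{W}$ and $\mathbb{V}$ be two closed subspaces of $\mathbb{X}$, and let $P:\mathbb{X}\to\mathbb{V}$ be the $M$-orthogonal projection, i.e. $M(x-Px,v)=0$ for all $x\in\mathbb{X}$ and $v\in\mathbb{V}$. Suppose there exists a constant $\alpha$ such that $$\|x-Px\|_N\leq \alpha\,\|x-Px\|_M\qquad\text{for all } x\in\mathbb{X}.$$ Let $\lambda_k^{\mathbb{W}}$ and $\lambda_k^{\mathbb{V}}$ denote the $k$-th eigenvalues (in nondecreasing order, counted with multiplicity) of the eigenvalue problem for the pair $(M,N)$ on $\mathbb{W}$ and on $\mathbb{V}$, respectively. Then $$\frac{\lambda_k^{\mathbb{V}}}{1+\alpha^2\lambda_k^{\mathbb{V}}}\leq\lambda_k^{\mathbb{W}}$$ for every $k=1,2,\dots$ for which both $\lambda_k^{\mathbb{W}}$ and $\lambda_k^{\mathbb{V}}$ exist.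
   Context: For $x\in\mathbb{X}$, the element $\gamma x\in\mathbb{Y}$ is again written $x$; thus for $x,y\in\mathbb{X}$, $N(x,y)$ means $N(\gamma x,\gamma y)$. Coercive means that there is $c>0$ with $M(x,x)\ge c\|x\|_{\mathbb{X}}^2$ for all $x\in\mathbb{X}$. Notation: $\|x\|_M:=\sqrt{M(x,x)}$ (a norm on $\mathbb{X}$) and $\|x\|_N:=\sqrt{N(x,x)}$ (a seminorm). For a closed subspace $\mathbb{U}\subset\mathbb{X}$ (here $\mathbb{U}=\mathbb{W}$ or $\mathbb{U}=\mathbb{V}$), the eigenvalue problem on $\mathbb{U}$ is: find $(\lambda,u)\in\mathbb{R}\times\mathbb{U}$ with $N(u,u)=1$ and $$M(u,v)=\lambda N(u,v)\qquad\text{for all } v\in\mathbb{U}.$$ Its eigenpairs are listed as $(\lambda_k^{\mathbb{U}},u_k^{\mathbb{U}})$, $k=1,2,\dots$, with $0<\lambda_1^{\mathbb{U}}\leq\lambda_2^{\mathbb{U}}\leq\cdots$ (all eigenvalues, each repeated according to its multiplicity) and $N(u_i^{\mathbb{U}},u_j^{\mathbb{U}})=\delta_{ij}$. The list may be finite, e.g. when $\mathbb{U}$ is finite-dimensional. With the Rayleigh quotient $R(x):=M(x,x)/N(x,x)$, defined when $N(x,x)\neq 0$, the eigenvalues satisfy the min-max principle $$\lambda_k^{\mathbb{U}}=\min_{S}\max_{0\neq u\in S}R(u),$$ where $S$ ranges over the $k$-dimensional subspaces of $\mathbb{U}$ that meet $\{u\in\mathbb{U}: N(u,u)=0\}$ only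 in $0$. *)

theory Defs
  imports "HOL-Analysis.Analysis" "HOL-Library.Extended_Nat"
begin

definition compact_operator :: "('a::real_normed_vector \<Rightarrow> 'b::real_normed_vector) \<Rightarrow> bool" where
  "compact_operator g \<longleftrightarrow> linear g \<and> (\<forall>B. bounded B \<longrightarrow> compact (closure (g ` B)))"

definition symmetric_form :: "('a \<Rightarrow> 'a \<Rightarrow> real) \<Rightarrow> bool" where
  "symmetric_form B \<longleftrightarrow> (\<forall>x y. B x y = B y x)"

definition coercive_form :: "('a::real_normed_vector \<Rightarrow> 'a \<Rightarrow> real) \<Rightarrow> bool" where
  "coercive_form B \<longleftrightarrow> (\<exists>c>0. \<forall>x. B x x \<ge> c * (norm x)\<^sup>2)"

definition pos_semidef_form :: "('a \<Rightarrow> 'a \<Rightarrow> real) \<Rightarrow> bool" where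
  "pos_semidef_form B \<longleftrightarrow> (\<forall>x. B x x \<ge> 0)"

definition form_norm :: "('a \<Rightarrow> 'a \<Rightarrow> real) \<Rightarrow> 'a \<Rightarrow> real" where
  "form_norm B x = sqrt (B x x)"

(* The form N on Y, read as a form on X through the embedding g. *)
definition pullback_form :: "('a \<Rightarrow> 'b) \<Rightarrow> ('b \<Rightarrow> 'b \<Rightarrow> real) \<Rightarrow> 'a \<Rightarrow> 'a \<Rightarrow> real" where
  "pullback_form g N x y = N (g x) (g y)"

definition is_M_projection ::
  "('a::real_vector \<Rightarrow> 'a \<Rightarrow> real) \<Rightarrow> 'a set \<Rightarrow> ('a \<Rightarrow> 'a) \<Rightarrow> bool" where
  "is_M_projection M V P \<longleftrightarrow> (\<forall>x. P x \<in> V) \<and> (\<forall>x. \<forall>v\<in>V. M (x - P x) v = 0)"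

definition eigenspace ::
  "('a \<Rightarrow> 'a \<Rightarrow> real) \<Rightarrow> ('a \<Rightarrow> 'a \<Rightarrow> real) \<Rightarrow> 'a set \<Rightarrow> real \<Rightarrow> 'a set" where
  "eigenspace M N U \<mu> = {u \<in> U. \<forall>v\<in>U. M u v = \<mu> * N u v}"

definition eigenpair ::
  "('a \<Rightarrow> 'a \<Rightarrow> real) \<Rightarrow> ('a \<Rightarrow> 'a \<Rightarrow> real) \<Rightarrow> 'a set \<Rightarrow> real \<Rightarrow> 'a \<Rightarrow> bool" where
  "eigenpair M N U \<mu> u \<longleftrightarrow> u \<in> U \<and> N u u = 1 \<and> (\<forall>v\<in>U. M u v = \<mu> * N u v)"

(* Positions 1, ..., K of a list of length K; all positive naturals if K is infinite. *)
definition positions :: "enat \<Rightarrow> nat set" where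
  "positions K = {k. 1 \<le> k \<and> enat k \<le> K}"

(* The list of eigenpairs on U, of finite or infinite length K. The last conjunct says that
   no eigenvalue is omitted and that each is repeated according to its multiplicity:
   for every eigenvalue mu the u k with lam k = mu, being N-orthonormal and hence linearly
   independent, form a basis of the eigenspace of mu (finite-dimensional by compactness of
   the embedding), so mu is listed exactly as often as the dimension of its eigenspace.
   If mu is not an eigenvalue, both sides are the null space. *)
definition eigenpair_list ::
  "('a::real_vector \<Rightarrow> 'a \<Rightarrow> real) \<Rightarrow> ('a \<Rightarrow> 'a \<Rightarrow> real) \<Rightarrow> 'a set \<Rightarrow>
   enat \<Rightarrow> (nat \<Rightarrow> real) \<Rightarrow> (nat \<Rightarrow> 'a) \<Rightarrow> bool" where
  "eigenpair_list M N U K lam u \<longleftrightarrow>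
     (\<forall>k\<in>positions K. 0 < lam k \<and> eigenpair M N U (lam k) (u k)) \<and>
     (\<forall>i\<in>positions K. \<forall>j\<in>positions K. i \<le> j \<longrightarrow> lam i \<le> lam j) \<and>
     (\<forall>i\<in>positions K. \<forall>j\<in>positions K. N (u i) (u j) = (if i = j then 1 else 0)) \<and>
     (\<forall>\<mu>. eigenspace M N U \<mu> = span (u ` {k \<in> positions K. lam k = \<mu>}))"

end

theory Submission
  imports Defs
begin

text \<open>
  In the span of the first \<open>k\<close> eigenvectors on \<open>W\<close> there is \<open>x \<noteq> 0\<close> that is \<open>M\<close>-orthogonal to the
  first \<open>k - 1\<close> eigenvectors on \<open>V\<close>. Since these are eigenvectors, \<open>P x\<close> is \<open>N\<close>-orthogonal to them,
  so \<open>\<Lambda> N(P x, P x) \<le> M(P x, P x)\<close> with \<open>\<Lambda>\<close> the \<open>k\<close>-th eigenvalue on \<open>V\<close>. With the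
  triangle inequality, the Cauchy--Schwarz inequality and the Pythagorean identity for \<open>M\<close>,
  \<open>N(x, x) \<le> (1/\<Lambda> + \<alpha>\<^sup>2) M(x, x)\<close>, while \<open>M(x, x) \<le> \<lambda> N(x, x)\<close> with \<open>\<lambda>\<close> the \<open>k\<close>-th eigenvalue
  on \<open>W\<close>. No injectivity of \<open>P\<close> on the span is needed.
\<close>

section \<open>Linear algebra: underdetermined systems and the Cauchy-Schwarz inequality\<close>

lemma homogeneous_system_solution:
  fixes A :: "'i \<Rightarrow> 'j \<Rightarrow> real"
  assumes "finite I" "finite J" "card I < card J"
  obtains a where "\<exists>j\<in>J. a j \<noteq> 0" "\<And>i. i \<in> I \<Longrightarrow> (\<Sum>j\<in>J. a j * A i j) = 0"
proof -
  have "\<exists>a. (\<exists>j\<in>J. a j \<noteq> 0) \<and> (\<forall>i\<in>I. (\<Sum>j\<in>J. a j * A i j) = 0)"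
    using assms
  proof (induction I arbitrary: A J rule: finite_induct)
    case empty
    then show ?case
      by (intro exI[of _ "\<lambda>_. 1"]) (auto simp: card_gt_0_iff)
  next
    case (insert i I)
    show ?case
    proof (cases "\<forall>j\<in>J. A i j = 0")
      case True
      have "card I < card J" using insert.hyps insert.prems by simp
      then obtain a where "\<exists>j\<in>J. a j \<noteq> 0" "\<forall>i\<in>I. (\<Sum>j\<in>J. a j * A i j) = 0"
        using insert.IH insert.prems(1) by blast
      with True show ?thesis by (intro exI[of _ a]) simp
    next
      case False
      then obtain j0 where j0: "j0 \<in> J" "A i j0 \<noteq> 0" by blast
      define J' where "J' = J - {j0}"
      \<comment> \<open>\<open>A' k\<close> is what remains of equation \<open>k\<close> after
        equation \<open>i\<close> has been solved for the unknown \<open>j0\<close> and the result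
        substituted.\<close>
      define A' where "A' = (\<lambda>k j. A k j - A k j0 * A i j / A i j0)"
      have J': "finite J'" "J = insert j0 J'" "j0 \<notin> J'"
        using j0 insert.prems by (auto simp: J'_def)
      then have "card I < card J'"
        using insert.hyps insert.prems by simp
      then obtain a where a: "\<exists>j\<in>J'. a j \<noteq> 0" "\<forall>k\<in>I. (\<Sum>j\<in>J'. a j * A' k j) = 0"
        using insert.IH[of J' A'] J'(1) by blast
      \<comment> \<open>Back substitution: \<open>t\<close> is the value at \<open>j0\<close> that
        makes equation \<open>i\<close> hold.\<close>
      define t where "t = - (\<Sum>j\<in>J'. a j * A i j) / A i j0"
      have sum_upd: "(\<Sum>j\<in>J. (a(j0 := t)) j * A k j) = t * A k j0 + (\<Sum>j\<in>J'. a j * A k j)" for k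
      proof -
        have "(\<Sum>j\<in>J'. (a(j0 := t)) j * A k j) = (\<Sum>j\<in>J'. a j * A k j)"
          using J'(3) by (intro sum.cong) auto
        then show ?thesis using J' by simp
      qed
      have "(\<Sum>j\<in>J. (a(j0 := t)) j * A k j) = 0" if "k \<in> insert i I" for k
      proof (cases "k = i")
        case True
        then show ?thesis unfolding sum_upd using j0 by (simp add: t_def)
      next
        case False
        have "(\<Sum>j\<in>J'. a j * A' k j)
            = (\<Sum>j\<in>J'. a j * A k j) - A k j0 / A i j0 * (\<Sum>j\<in>J'. a j * A i j)"
          by (simp add: A'_def algebra_simps sum_subtractf sum_distrib_left)
        also have "\<dots> = t * A k j0 + (\<Sum>j\<in>J'. a j * A k j)"
          by (simp add: t_def)
        finally show ?thesis
          unfolding sum_upd using a(2) that False by simp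
      qed
      moreover have "\<exists>j\<in>J. (a(j0 := t)) j \<noteq> 0"
        using a(1) J' by auto
      ultimately show ?thesis by blast
    qed
  qed
  then show thesis using that by blast
qed

text \<open>The quadratic form is nonnegative on the plane spanned by \<open>x\<close> and
  \<open>y\<close>, and suitable coefficients \<open>s\<close>, \<open>t\<close> give the
  inequality. Positivity is asked on \<open>U\<close> only, because the form \<open>Q\<close> built
  from a Rayleigh extremum is known to be nonnegative just there.\<close>

lemma semidefinite_Cauchy_Schwarz:
  assumes "bilinear B" "symmetric_form B" "subspace U"
    and nonneg: "\<And>z. z \<in> U \<Longrightarrow> 0 \<le> B z z" and "x \<in> U" "y \<in> U"
  shows "(B x y)\<^sup>2 \<le> B x x * B y y"
proof -
  have sym: "B y x = B x y" using assms(2) by (simp add: symmetric_form_def)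
  have *: "0 \<le> s\<^sup>2 * B x x + 2 * s * t * B x y + t\<^sup>2 * B y y" for s t
  proof -
    have "s *\<^sub>R x + t *\<^sub>R y \<in> U"
      using assms by (intro subspace_add subspace_scale)
    from nonneg[OF this] show ?thesis
      by (simp add: assms(1) bilinear_ladd bilinear_radd bilinear_lmul bilinear_rmul sym
          algebra_simps power2_eq_square)
  qed
  show ?thesis
  proof (cases "B y y = 0")
    case True
    have "B x y = 0"
    proof (rule ccontr)
      assume "B x y \<noteq> 0"
      \<comment> \<open>With \<open>B y y = 0\<close> the quadratic is affine in \<open>t\<close>;
        the chosen \<open>t\<close> gives it the value -1.\<close>
      then show False
        using *[of 1 "- (B x x + 1) / (2 * B x y)"] True nonneg[OF \<open>x \<in> U\<close>]
        by (simp add: field_simps)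
    qed
    with True show ?thesis by simp
  next
    case False
    then have "B y y > 0" using nonneg[OF \<open>y \<in> U\<close>] by simp
    moreover have "0 \<le> B y y * (B x x * B y y - (B x y)\<^sup>2)"
      using *[of "B y y" "- B x y"] by (simp add: algebra_simps power2_eq_square)
    ultimately show ?thesis by (simp add: zero_le_mult_iff)
  qed
qed

section \<open>Bounded forms and compact embeddings\<close>

lemma bounded_bilinear_imp_bilinear:
  assumes "bounded_bilinear B"
  shows "bilinear B"
  unfolding bilinear_def
  by (intro conjI allI bounded_linear.linear bounded_bilinear.bounded_linear_left[OF assms]
      bounded_bilinear.bounded_linear_right[OF assms])

lemma pullback_form_bounded_bilinear:
  assumes "bounded_bilinear N" "bounded_linear g"
  shows "bounded_bilinear (pullback_form g N)"
  unfolding pullback_form_def[abs_def] by (rule bounded_bilinear.comp[OF assms(1,2,2)])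

lemma compact_operator_Cauchy_subseq:
  fixes f :: "nat \<Rightarrow> 'a::real_normed_vector" and g :: "'a \<Rightarrow> 'b::real_normed_vector"
  assumes "compact_operator g" "bounded (range f)"
  obtains r where "strict_mono r" "Cauchy (\<lambda>k. g (f (r k)))"
proof -
  have "compact (closure (g ` range f))"
    using assms by (simp add: compact_operator_def)
  moreover have "\<forall>k. g (f k) \<in> closure (g ` range f)"
    by (intro allI subsetD[OF closure_subset] imageI rangeI)
  ultimately obtain l r where "strict_mono r" "((\<lambda>k. g (f k)) \<circ> r) \<longlonglongrightarrow> l"
    unfolding compact_def by (elim allE[where x = "\<lambda>k. g (f k)"] impE) auto
  then show thesis
    using that LIMSEQ_imp_Cauchy by (auto simp: comp_def)
qed

section \<open>Attainment of the extremal Rayleigh quotient\<close>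

text \<open>Maximize \<open>n x x\<close> over the \<open>M\<close>-unit sphere of \<open>U\<close>.
  The maximum \<open>s\<close> is attained at some \<open>w\<close>, and
  \<open>\<mu> = 1 / s\<close> is the least Rayleigh quotient. The eigenvalue equation is the
  first-order condition at \<open>w\<close>, obtained from Cauchy-Schwarz instead of
  differentiation.\<close>

lemma Rayleigh_quotient_extremum:
  fixes \<gamma> :: "'x::{real_inner,complete_space} \<Rightarrow> 'y::real_normed_vector"
  assumes \<gamma>: "bounded_linear \<gamma>" "compact_operator \<gamma>"
    and M: "bounded_bilinear M" "symmetric_form M" "coercive_form M"
    and N: "bounded_bilinear N" "symmetric_form N" "pos_semidef_form N"
    and U: "subspace U" "closed U"
    and n_def: "n = pullback_form \<gamma> N"
    and v: "v \<in> U" "n v v > 0"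
  obtains w \<mu> where "w \<in> U" "n w w > 0"
    "\<And>x. x \<in> U \<Longrightarrow> \<mu> * n x x \<le> M x x" "\<And>x. x \<in> U \<Longrightarrow> M w x = \<mu> * n w x"
proof -
  have n: "bounded_bilinear n"
    unfolding n_def using N(1) \<gamma>(1) by (rule pullback_form_bounded_bilinear)
  have n_sym: "symmetric_form n"
    using N(2) by (simp add: n_def symmetric_form_def pullback_form_def)
  have n_nonneg: "0 \<le> n x x" for x
    using N(3) by (simp add: n_def pos_semidef_form_def pullback_form_def)
  obtain c where c: "c > 0" "\<And>x. c * (norm x)\<^sup>2 \<le> M x x"
    using M(3) by (auto simp: coercive_form_def)
  have M_pos: "0 < M x x" if "x \<noteq> 0" for x
    using c(2)[of x] c(1) that by (smt (verit) mult_pos_pos zero_less_norm_iff zero_less_power)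
  have M_nonneg: "0 \<le> M x x" for x
    using c(2)[of x] c(1) by (smt (verit) mult_nonneg_nonneg zero_le_power2)
  note bil = bounded_bilinear_imp_bilinear
  note expand = bilinear_ladd bilinear_radd bilinear_lsub bilinear_rsub bilinear_lmul bilinear_rmul
  have scaled: "B (a *\<^sub>R x) (a *\<^sub>R x) = a\<^sup>2 * B x x" if "bounded_bilinear B" for B a and x :: 'x
    using bil[OF that] by (simp add: bilinear_lmul bilinear_rmul power2_eq_square)
  obtain Kn where Kn: "Kn > 0" "\<And>x y. norm (n x y) \<le> norm x * norm y * Kn"
    using bounded_bilinear.pos_bounded[OF n] by blast
  obtain KN where KN: "KN > 0" "\<And>x y. norm (N x y) \<le> norm x * norm y * KN"
    using bounded_bilinear.pos_bounded[OF N(1)] by blast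
  define E where "E = {x \<in> U. M x x = 1}"
  define s where "s = (SUP x\<in>E. n x x)"
  have normalize: "(1 / sqrt (M x x)) *\<^sub>R x \<in> E"
    "n ((1 / sqrt (M x x)) *\<^sub>R x) ((1 / sqrt (M x x)) *\<^sub>R x) = n x x / M x x"
    if "x \<in> U" "x \<noteq> 0" for x
    using that M_pos[of x] U(1)
    by (auto simp: E_def scaled[OF M(1)] scaled[OF n] power_divide subspace_scale)
  have E_norm: "(norm x)\<^sup>2 \<le> 1 / c" if "x \<in> E" for x
    using c(2)[of x] that c(1) by (simp add: E_def field_simps)
  have bdd: "bdd_above ((\<lambda>x. n x x) ` E)"
  proof (rule bdd_aboveI2)
    fix x assume "x \<in> E"
    have "n x x \<le> (norm x)\<^sup>2 * Kn"
      using Kn(2)[of x x] by (simp add: power2_eq_square)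
    also have "\<dots> \<le> 1 / c * Kn"
      using E_norm[OF \<open>x \<in> E\<close>] Kn(1) by (intro mult_right_mono) auto
    finally show "n x x \<le> 1 / c * Kn" .
  qed
  have n_zero: "n 0 0 = 0" using bounded_bilinear.zero_left[OF n] .
  have v0: "v \<noteq> 0" using v n_zero by auto
  have "0 < n v v / M v v" using v M_pos[OF v0] by simp
  also have "\<dots> \<le> s"
    using cSUP_upper[OF normalize(1)[OF v(1) v0] bdd] normalize(2)[OF v(1) v0]
    by (simp add: s_def)
  finally have s_pos: "0 < s" .
  have n_le: "n x x \<le> s * M x x" if "x \<in> U" for x
  proof (cases "x = 0")
    case True
    then show ?thesis using n_zero s_pos M_nonneg by simp
  next
    case False
    have "n x x / M x x \<le> s"
      using cSUP_upper[OF normalize(1)[OF that False] bdd] normalize(2)[OF that False]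
      by (simp add: s_def)
    then show ?thesis using M_pos[OF False] by (simp add: field_simps)
  qed
  have "\<exists>x\<in>E. s - 1 / real (Suc k) < n x x" for k
  proof -
    have "E \<noteq> {}" using normalize(1)[OF v(1) v0] by blast
    then show ?thesis
      using less_cSUP_iff[of E "\<lambda>x. n x x" "s - 1 / real (Suc k)"] bdd by (simp add: s_def)
  qed
  then obtain f where f: "\<And>k. f k \<in> E" "\<And>k. s - 1 / real (Suc k) < n (f k) (f k)"
    by metis
  have "bounded (range f)"
  proof (rule boundedI)
    fix y assume "y \<in> range f"
    then show "norm y \<le> sqrt (1 / c)"
      using E_norm f(1) by (auto intro: real_le_rsqrt)
  qed
  then obtain r where r: "strict_mono r" "Cauchy (\<lambda>k. \<gamma> (f (r k)))"
    using compact_operator_Cauchy_subseq[OF \<gamma>(2)] by blast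
  define h where "h = (\<lambda>k. f (r k))"
  have hE: "h k \<in> U" "M (h k) (h k) = 1" for k
    using f(1)[of "r k"] by (auto simp: h_def E_def)
  have h_lim: "(\<lambda>k. n (h k) (h k)) \<longlonglongrightarrow> s"
  proof (rule tendsto_sandwich)
    have "(\<lambda>k. s - 1 / real (Suc k)) \<longlonglongrightarrow> s - 0"
      by (intro tendsto_diff tendsto_const LIMSEQ_Suc lim_1_over_n)
    then show "(\<lambda>k. s - 1 / real (Suc (r k))) \<longlonglongrightarrow> s"
      using LIMSEQ_subseq_LIMSEQ[OF _ r(1)] by (fastforce simp: comp_def)
    show "\<forall>\<^sub>F k in sequentially. s - 1 / real (Suc (r k)) \<le> n (h k) (h k)"
      using f(2) by (auto simp: h_def less_imp_le)
    show "\<forall>\<^sub>F k in sequentially. n (h k) (h k) \<le> s"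
      using n_le hE by (metis (mono_tags, lifting) always_eventually mult.right_neutral)
  qed simp
  \<comment> \<open>Once \<open>\<gamma> \<circ> h\<close> is Cauchy, the parallelogram identity for both forms makes the maximizing
    sequence itself Cauchy, so no weak compactness is needed.\<close>
  have parallelogram: "c * (norm (h i - h j))\<^sup>2
      \<le> 4 - (2 * n (h i) (h i) + 2 * n (h j) (h j) - n (h i - h j) (h i - h j)) / s" for i j
  proof -
    have par: "B (h i - h j) (h i - h j) + B (h i + h j) (h i + h j)
      = 2 * B (h i) (h i) + 2 * B (h j) (h j)" if "bounded_bilinear B" for B :: "'x \<Rightarrow> 'x \<Rightarrow> real"
      using bil[OF that] by (simp add: expand)
    have "n (h i + h j) (h i + h j) / s \<le> M (h i + h j) (h i + h j)"
      using n_le[of "h i + h j"] hE(1) U(1) s_pos by (simp add: subspace_add field_simps)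
    moreover have "n (h i + h j) (h i + h j)
        = 2 * n (h i) (h i) + 2 * n (h j) (h j) - n (h i - h j) (h i - h j)"
      using par[OF n] by simp
    ultimately show ?thesis
      using par[OF M(1)] hE(2) c(2)[of "h i - h j"] by simp
  qed
  have "Cauchy h"
  proof (rule metric_CauchyI)
    fix e :: real assume e: "e > 0"
    \<comment> \<open>The error budget is \<open>5 * d\<close>: near-maximality of the two values of
      \<open>n\<close> costs \<open>4 * d\<close>, and the \<open>n\<close>-distance costs one more
      \<open>d\<close>. After division by \<open>s\<close> this is
      \<open>5 / 6 * c * e\<^sup>2\<close>, below the target.\<close>
    define d where "d = s * c * e\<^sup>2 / 6"
    have d: "d > 0" using s_pos c(1) e by (simp add: d_def)
    have "\<forall>\<^sub>F k in sequentially. s - d < n (h k) (h k)"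
      using h_lim d by (auto intro: order_tendstoD)
    then obtain k1 where k1: "\<And>k. k \<ge> k1 \<Longrightarrow> s - d < n (h k) (h k)"
      by (auto simp: eventually_sequentially)
    obtain k2 where k2: "\<And>i j. i \<ge> k2 \<Longrightarrow> j \<ge> k2 \<Longrightarrow> norm (\<gamma> (h i) - \<gamma> (h j)) < sqrt (d / KN)"
      using CauchyD[OF r(2), of "sqrt (d / KN)"] d KN(1) by (auto simp: h_def)
    have "dist (h i) (h j) < e" if "i \<ge> max k1 k2" "j \<ge> max k1 k2" for i j
    proof -
      have "n (h i - h j) (h i - h j) \<le> (norm (\<gamma> (h i) - \<gamma> (h j)))\<^sup>2 * KN"
        using KN(2)[of "\<gamma> (h i) - \<gamma> (h j)" "\<gamma> (h i) - \<gamma> (h j)"]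
        by (simp add: n_def pullback_form_def linear_diff bounded_linear.linear[OF \<gamma>(1)]
            power2_eq_square)
      also have "\<dots> < (sqrt (d / KN))\<^sup>2 * KN"
        using k2[of i j] that KN(1) by (intro mult_strict_right_mono power_strict_mono) auto
      also have "\<dots> = d" using d KN(1) by simp
      finally have "4 * s - 5 * d < 2 * n (h i) (h i) + 2 * n (h j) (h j) - n (h i - h j) (h i - h j)"
        using k1[of i] k1[of j] that by simp
      then have "c * (norm (h i - h j))\<^sup>2 < 4 - (4 * s - 5 * d) / s"
        using parallelogram[of i j] s_pos
        by (smt (verit) divide_strict_right_mono)
      also have "\<dots> = c * (5 / 6 * e\<^sup>2)"
        using s_pos by (simp add: d_def field_simps)
      finally have "(norm (h i - h j))\<^sup>2 < 5 / 6 * e\<^sup>2" using c(1) by simp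
      then have "(norm (h i - h j))\<^sup>2 < e\<^sup>2" using zero_le_power2[of e] by linarith
      then show ?thesis using e by (simp add: dist_norm power2_less_imp_less)
    qed
    then show "\<exists>K. \<forall>i\<ge>K. \<forall>j\<ge>K. dist (h i) (h j) < e" by blast
  qed
  then obtain w where w: "h \<longlonglongrightarrow> w"
    using Cauchy_convergent convergent_def by blast
  have wU: "w \<in> U" using U(2) hE(1) w by (auto simp: closed_sequential_limits)
  have "(\<lambda>k. M (h k) (h k)) \<longlonglongrightarrow> M w w"
    using bounded_bilinear.tendsto[OF M(1) w w] .
  then have Mw: "M w w = 1" using hE(2) by (simp add: LIMSEQ_const_iff)
  have nw: "n w w = s"
    using bounded_bilinear.tendsto[OF n w w] h_lim LIMSEQ_unique by blast
  \<comment> \<open>\<open>Q\<close> is nonnegative on \<open>U\<close> and vanishes at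
    \<open>w\<close>, since \<open>M w w = 1\<close> and \<open>n w w = s\<close>. Cauchy-Schwarz
    then forces \<open>Q w x = 0\<close> for every \<open>x\<close> in \<open>U\<close>, which is
    the eigenvalue equation.\<close>
  define Q where "Q = (\<lambda>x y. s * M x y - n x y)"
  have "bilinear Q"
    using bil[OF M(1)] bil[OF n]
    by (auto simp: Q_def bilinear_def linear_iff algebra_simps)
  moreover have "symmetric_form Q"
    using M(2) n_sym by (simp add: Q_def symmetric_form_def)
  moreover have "0 \<le> Q x x" if "x \<in> U" for x
    using n_le[OF that] by (simp add: Q_def)
  ultimately have "(Q w x)\<^sup>2 \<le> Q w w * Q x x" if "x \<in> U" for x
    using semidefinite_Cauchy_Schwarz[of Q U w x] U(1) wU that by blast
  then have Q0: "Q w x = 0" if "x \<in> U" for x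
    using that by (simp add: Q_def Mw nw)
  show thesis
  proof
    show "w \<in> U" "n w w > 0" using wU nw s_pos by auto
    show "1 / s * n x x \<le> M x x" if "x \<in> U" for x
      using n_le[OF that] s_pos by (simp add: field_simps)
    show "M w x = 1 / s * n w x" if "x \<in> U" for x
      using Q0[OF that] s_pos by (simp add: Q_def field_simps)
  qed
qed

section \<open>Rayleigh quotients orthogonal to the first eigenvectors\<close>

text \<open>Deflation: the least Rayleigh quotient on the \<open>n\<close>-orthogonal complement of
  the first \<open>k - 1\<close> eigenvectors is attained at an eigenvector of the whole of
  \<open>V\<close>. Since the list omits no eigenvalue, its eigenvalue is at least
  \<open>lam k\<close>. Vectors with \<open>n v v = 0\<close> satisfy the bound trivially.\<close>

lemma Rayleigh_lower_bound:
  fixes \<gamma> :: "'x::{real_inner,complete_space} \<Rightarrow> 'y::real_normed_vector"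
  assumes \<gamma>: "bounded_linear \<gamma>" "compact_operator \<gamma>"
    and M: "bounded_bilinear M" "symmetric_form M" "coercive_form M"
    and N: "bounded_bilinear N" "symmetric_form N" "pos_semidef_form N"
    and V: "subspace V" "closed V"
    and n_def: "n = pullback_form \<gamma> N"
    and list: "eigenpair_list M n V K lam u"
    and k: "k \<in> positions K"
    and v: "v \<in> V" "\<And>i. 1 \<le> i \<Longrightarrow> i < k \<Longrightarrow> n v (u i) = 0"
  shows "lam k * n v v \<le> M v v"
proof (cases "n v v > 0")
  case False
  moreover have "0 \<le> n v v"
    using N(3) by (simp add: n_def pos_semidef_form_def pullback_form_def)
  moreover have "0 \<le> M v v"
    using M(3) by (auto simp: coercive_form_def) (meson mult_nonneg_nonneg less_imp_le order_trans zero_le_power2)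
  ultimately show ?thesis by simp
next
  case True
  have n: "bounded_bilinear n"
    unfolding n_def using N(1) \<gamma>(1) by (rule pullback_form_bounded_bilinear)
  have n_sym: "n x y = n y x" and M_sym: "M x y = M y x" for x y
    using N(2) M(2) by (auto simp: n_def symmetric_form_def pullback_form_def)
  have pos: "i \<in> positions K" if "1 \<le> i" "i \<le> k" for i
    using k that by (auto simp: positions_def intro: order_trans[of "enat i" "enat k"])
  define I where "I = {1..<k}"
  have I: "i \<in> positions K" if "i \<in> I" for i using pos that by (simp add: I_def)
  have u: "u i \<in> V" "\<And>x. x \<in> V \<Longrightarrow> M (u i) x = lam i * n (u i) x" if "i \<in> positions K" for i
    using list that by (auto simp: eigenpair_list_def eigenpair_def)
  have orth: "n (u i) (u j) = (if i = j then 1 else 0)"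
    if "i \<in> positions K" "j \<in> positions K" for i j
    using list that by (auto simp: eigenpair_list_def)
  define U where "U = {x \<in> V. \<forall>i\<in>I. n x (u i) = 0}"
  have "subspace U"
    using V(1) bounded_bilinear.add_left[OF n] bounded_bilinear.scaleR_left[OF n]
      bounded_bilinear.zero_left[OF n]
    by (auto simp: U_def subspace_def)
  moreover have "closed U"
  proof -
    have "closed {x. n x (u i) = 0}" for i
      using linear_continuous_on[OF bounded_bilinear.bounded_linear_left[OF n, of "u i"], of UNIV]
      by (intro closed_Collect_eq) auto
    moreover have "U = V \<inter> (\<Inter>i\<in>I. {x. n x (u i) = 0})" by (auto simp: U_def)
    ultimately show ?thesis using V(2) by auto
  qed
  moreover have "v \<in> U" using v by (simp add: U_def I_def)
  ultimately obtain w \<mu> where w: "w \<in> U" "n w w > 0"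
    and \<mu>: "\<And>x. x \<in> U \<Longrightarrow> \<mu> * n x x \<le> M x x" "\<And>x. x \<in> U \<Longrightarrow> M w x = \<mu> * n w x"
    using Rayleigh_quotient_extremum[OF \<gamma> M N _ _ n_def _ True, of U] by blast
  have wV: "w \<in> V" and wu: "\<And>i. i \<in> I \<Longrightarrow> n w (u i) = 0"
    using w(1) by (auto simp: U_def)
  have Mwu: "M w (u i) = 0" if "i \<in> I" for i
    using u(2)[OF I[OF that] wV] wu[OF that] n_sym M_sym by simp
  \<comment> \<open>Both sides vanish at the \<open>u i\<close> with \<open>i < k\<close>, so the equation extends from \<open>U\<close> to \<open>V\<close>.\<close>
  have "M w x = \<mu> * n w x" if x: "x \<in> V" for x
  proof -
    \<comment> \<open>\<open>y\<close> is the \<open>n\<close>-orthogonal projection of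
      \<open>x\<close> onto the span of the first \<open>k - 1\<close> eigenvectors, so
      \<open>x - y\<close> lies in \<open>U\<close>.\<close>
    define y where "y = (\<Sum>i\<in>I. n x (u i) *\<^sub>R u i)"
    have "n y (u j) = n x (u j)" if "j \<in> I" for j
    proof -
      have "n y (u j) = (\<Sum>i\<in>I. n x (u i) * n (u i) (u j))"
        by (simp add: y_def bounded_bilinear.sum_left[OF n] bounded_bilinear.scaleR_left[OF n])
      also have "\<dots> = (\<Sum>i\<in>I. if i = j then n x (u i) else 0)"
        by (rule sum.cong) (auto simp: orth I that)
      finally show ?thesis using that by (simp add: I_def)
    qed
    moreover have "y \<in> V"
      unfolding y_def using V(1) u(1) I by (intro subspace_sum subspace_scale) auto
    ultimately have "x - y \<in> U"
      using x V(1) by (simp add: U_def subspace_diff bounded_bilinear.diff_left[OF n])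
    then have "M w (x - y) = \<mu> * n w (x - y)" by (rule \<mu>(2))
    moreover have "n w y = 0"
      by (simp add: y_def bounded_bilinear.sum_right[OF n] bounded_bilinear.scaleR_right[OF n] wu)
    moreover have "M w y = 0"
      by (simp add: y_def bounded_bilinear.sum_right[OF M(1)] bounded_bilinear.scaleR_right[OF M(1)] Mwu)
    ultimately show ?thesis
      by (simp add: bounded_bilinear.diff_right[OF n] bounded_bilinear.diff_right[OF M(1)])
  qed
  with wV have "w \<in> eigenspace M n V \<mu>" by (simp add: eigenspace_def)
  then have w_span: "w \<in> span (u ` {j \<in> positions K. lam j = \<mu>})"
    using list by (simp add: eigenpair_list_def)
  have "lam k \<le> \<mu>"
  proof (rule ccontr)
    assume less: "\<not> lam k \<le> \<mu>"
    \<comment> \<open>By monotonicity, every index listed with a value smaller than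
      \<open>lam k\<close> precedes \<open>k\<close>. Hence \<open>w\<close> is
      \<open>n\<close>-orthogonal to the whole span that contains it, so \<open>n w w = 0\<close>, a
      contradiction. If \<open>\<mu>\<close> is not listed, the span is zero and the same argument
      applies.\<close>
    have below: "j \<in> I" if "j \<in> positions K" "lam j = \<mu>" for j
    proof -
      have "\<not> k \<le> j"
        using list k that less by (auto simp: eigenpair_list_def)
      then show ?thesis using that by (simp add: I_def positions_def)
    qed
    have "subspace {x. n w x = 0}"
      using bounded_bilinear.add_right[OF n] bounded_bilinear.scaleR_right[OF n]
        bounded_bilinear.zero_right[OF n]
      by (auto simp: subspace_def)
    then have "span (u ` {j \<in> positions K. lam j = \<mu>}) \<subseteq> {x. n w x = 0}"
      using below wu by (intro span_minimal) auto
    then show False using w_span w(2) by auto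
  qed
  then have "lam k * n v v \<le> \<mu> * n v v" using True by simp
  also have "\<dots> \<le> M v v" using \<mu>(1) \<open>v \<in> U\<close> .
  finally show ?thesis .
qed

section \<open>Comparison of the eigenvalues on \<open>W\<close> and \<open>V\<close>\<close>

theorem theorem2p1:
  fixes \<gamma> :: "'x::{real_inner,complete_space} \<Rightarrow> 'y::{real_inner,complete_space}"
    and M :: "'x \<Rightarrow> 'x \<Rightarrow> real"
    and N :: "'y \<Rightarrow> 'y \<Rightarrow> real"
    and W V :: "'x set"
    and P :: "'x \<Rightarrow> 'x"
    and \<alpha> :: real
    and KW KV :: enat
    and lamW lamV :: "nat \<Rightarrow> real"
    and uW uV :: "nat \<Rightarrow> 'x"
  assumes "bounded_linear \<gamma>" "inj \<gamma>" "compact_operator \<gamma>"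
    and "bounded_bilinear M" "symmetric_form M" "coercive_form M"
    and "bounded_bilinear N" "symmetric_form N" "pos_semidef_form N"
    and "subspace W" "closed W"
    and "subspace V" "closed V"
    and "is_M_projection M V P"
    and "\<forall>x. form_norm (pullback_form \<gamma> N) (x - P x) \<le> \<alpha> * form_norm M (x - P x)"
    and "eigenpair_list M (pullback_form \<gamma> N) W KW lamW uW"
    and "eigenpair_list M (pullback_form \<gamma> N) V KV lamV uV"
  shows "\<forall>k. k \<in> positions KW \<and> k \<in> positions KV \<longrightarrow>
           lamV k / (1 + \<alpha>\<^sup>2 * lamV k) \<le> lamW k"
proof (intro allI impI, elim conjE)
  fix k assume kW: "k \<in> positions KW" and kV: "k \<in> positions KV"
  define n where "n = pullback_form \<gamma> N"
  note M = assms(4)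
  have n: "bounded_bilinear n"
    unfolding n_def using assms(7,1) by (rule pullback_form_bounded_bilinear)
  have n_sym: "n x y = n y x" and M_sym: "M x y = M y x" for x y
    using assms(5,8) by (auto simp: n_def symmetric_form_def pullback_form_def)
  have n_nonneg: "0 \<le> n x x" for x
    using assms(9) by (simp add: n_def pos_semidef_form_def pullback_form_def)
  have M_nonneg: "0 \<le> M x x" for x
    using assms(6)
    by (auto simp: coercive_form_def) (meson mult_nonneg_nonneg less_imp_le order_trans zero_le_power2)
  have listW: "eigenpair_list M n W KW lamW uW" and listV: "eigenpair_list M n V KV lamV uV"
    using assms by (auto simp: n_def)
  have k1: "1 \<le> k" using kW by (simp add: positions_def)
  have posW: "i \<in> positions KW" and posV: "i \<in> positions KV" if "1 \<le> i" "i \<le> k" for i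
    using kW kV that by (auto simp: positions_def intro: order_trans[of "enat i" "enat k"])
  \<comment> \<open>There are \<open>k\<close> unknowns and \<open>k - 1\<close> equations. The
    equations say \<open>M x (uV i) = 0\<close> for the vector \<open>x\<close> defined
    next.\<close>
  obtain a where a: "\<exists>j\<in>{1..k}. a j \<noteq> 0"
    "\<And>i. i \<in> {1..<k} \<Longrightarrow> (\<Sum>j=1..k. a j * M (uW j) (uV i)) = 0"
    using homogeneous_system_solution[of "{1..<k}" "{1..k}" "\<lambda>i j. M (uW j) (uV i)"] k1 by auto
  define x where "x = (\<Sum>j=1..k. a j *\<^sub>R uW j)"
  have form_x: "B x y = (\<Sum>j=1..k. a j * B (uW j) y)" if "bounded_bilinear B" for B y
    by (simp add: x_def bounded_bilinear.sum_left[OF that] bounded_bilinear.scaleR_left[OF that])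
  have orthW: "n (uW i) (uW j) = (if i = j then 1 else 0)"
    and eigW: "M (uW i) (uW j) = lamW i * n (uW i) (uW j)"
    if "i \<in> {1..k}" "j \<in> {1..k}" for i j
    using listW posW that by (auto simp: eigenpair_list_def eigenpair_def)
  \<comment> \<open>The \<open>uW j\<close> are \<open>n\<close>-orthonormal and
    \<open>M\<close>-orthogonal, so both forms are diagonal in the coefficients and the Rayleigh
    quotient of \<open>x\<close> is a weighted mean of the \<open>lamW j\<close>.\<close>
  have n_coeff: "n (uW i) x = a i" if "i \<in> {1..k}" for i
  proof -
    have "n (uW i) x = (\<Sum>j=1..k. a j * n (uW j) (uW i))"
      using form_x[OF n] n_sym by metis
    also have "\<dots> = (\<Sum>j=1..k. if j = i then a j else 0)"
      using that by (intro sum.cong[OF refl]) (simp add: orthW)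
    finally show ?thesis using that by simp
  qed
  have M_coeff: "M (uW i) x = lamW i * a i" if "i \<in> {1..k}" for i
  proof -
    have "M (uW i) x = (\<Sum>j=1..k. a j * M (uW j) (uW i))"
      using form_x[OF M] M_sym by metis
    also have "\<dots> = (\<Sum>j=1..k. if j = i then lamW i * a j else 0)"
      using that by (intro sum.cong[OF refl]) (simp add: orthW eigW)
    finally show ?thesis using that by simp
  qed
  have nx: "n x x = (\<Sum>j=1..k. (a j)\<^sup>2)"
    unfolding form_x[OF n] by (rule sum.cong) (auto simp: n_coeff power2_eq_square)
  have nx_pos: "0 < n x x"
    unfolding nx using a(1) by (auto intro!: sum_pos2)
  have "M x x = (\<Sum>j=1..k. lamW j * (a j)\<^sup>2)"
    unfolding form_x[OF M] by (rule sum.cong) (auto simp: M_coeff power2_eq_square)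
  also have "\<dots> \<le> (\<Sum>j=1..k. lamW k * (a j)\<^sup>2)"
    using listW posW kW by (intro sum_mono mult_right_mono) (auto simp: eigenpair_list_def)
  finally have Mx: "M x x \<le> lamW k * n x x"
    by (simp add: nx sum_distrib_left)

  define p where "p = P x"
  define e where "e = x - P x"
  have pV: "p \<in> V" and e_orth: "\<And>v. v \<in> V \<Longrightarrow> M e v = 0"
    using assms(14) by (auto simp: is_M_projection_def p_def e_def)
  have x_eq: "x = p + e" by (simp add: p_def e_def)
  have lamV_pos: "0 < lamV i" if "1 \<le> i" "i \<le> k" for i
    using listV posV that by (auto simp: eigenpair_list_def)
  define \<Lambda> where "\<Lambda> = lamV k"
  have \<Lambda>: "0 < \<Lambda>" using lamV_pos k1 by (simp add: \<Lambda>_def)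
  \<comment> \<open>\<open>M x (uV i) = 0\<close> passes to \<open>p\<close> because
    \<open>e\<close> is \<open>M\<close>-orthogonal to \<open>V\<close>; the eigenvalue equation
    with \<open>lamV i > 0\<close> then turns \<open>M\<close>-orthogonality into
    \<open>n\<close>-orthogonality.\<close>
  have "n p (uV i) = 0" if i: "1 \<le> i" "i < k" for i
  proof -
    have eig: "uV i \<in> V" "M (uV i) p = lamV i * n (uV i) p"
      using listV posV[of i] i pV by (auto simp: eigenpair_list_def eigenpair_def)
    have "M x (uV i) = 0" using a(2) i by (simp add: form_x[OF M])
    then have "M p (uV i) = 0"
      using e_orth[OF eig(1)] by (simp add: x_eq bounded_bilinear.add_left[OF M])
    then show ?thesis
      using eig(2) lamV_pos[of i] i n_sym M_sym by simp
  qed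
  then have "\<Lambda> * n p p \<le> M p p"
    unfolding \<Lambda>_def
    using Rayleigh_lower_bound[OF assms(1,3-9,12,13) n_def listV kV pV] by blast
  then have np: "n p p \<le> M p p / \<Lambda>" using \<Lambda> by (simp add: field_simps)
  have "sqrt (n e e) \<le> \<alpha> * sqrt (M e e)"
    using assms(15) by (simp add: form_norm_def n_def e_def)
  \<comment> \<open>Squaring is legitimate whatever the sign of \<open>\<alpha>\<close>, because the
    left side is nonnegative.\<close>
  then have "(sqrt (n e e))\<^sup>2 \<le> (\<alpha> * sqrt (M e e))\<^sup>2"
    using n_nonneg by (intro power_mono) auto
  then have ne: "n e e \<le> \<alpha>\<^sup>2 * M e e"
    using n_nonneg M_nonneg by (simp add: power_mult_distrib)

  \<comment> \<open>The cross term is split as \<open>4ab \<le> (a + b)\<^sup>2\<close> so that the case \<open>\<alpha> = 0\<close> needs no separate treatment.\<close>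
  have "(2 * n p e)\<^sup>2 \<le> 4 * (n p p * n e e)"
    using semidefinite_Cauchy_Schwarz[OF bounded_bilinear_imp_bilinear[OF n], of UNIV p e]
      n_sym n_nonneg by (simp add: symmetric_form_def power_mult_distrib)
  also have "\<dots> \<le> 4 * (M p p / \<Lambda> * (\<alpha>\<^sup>2 * M e e))"
    using np ne n_nonneg M_nonneg \<Lambda> by (intro mult_left_mono mult_mono) auto
  also have "\<dots> = 4 * (\<alpha>\<^sup>2 * M p p) * (M e e / \<Lambda>)" by simp
  also have "\<dots> \<le> (\<alpha>\<^sup>2 * M p p + M e e / \<Lambda>)\<^sup>2"
    using zero_le_power2[of "\<alpha>\<^sup>2 * M p p - M e e / \<Lambda>"] by (simp only: power2_sum power2_diff)
  finally have cross: "2 * n p e \<le> \<alpha>\<^sup>2 * M p p + M e e / \<Lambda>"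
    by (rule power2_le_imp_le) (use M_nonneg \<Lambda> in auto)
  have "n x x = n p p + 2 * n p e + n e e"
    using n_sym[of e p]
    by (simp add: x_eq bounded_bilinear.add_left[OF n] bounded_bilinear.add_right[OF n])
  \<comment> \<open>\<open>np\<close> and \<open>ne\<close> supply \<open>M p p / \<Lambda>\<close>
    and \<open>\<alpha>\<^sup>2 * M e e\<close>; \<open>cross\<close> supplies the two complementary
    products, so the sum factors exactly.\<close>
  also have "\<dots> \<le> (1 / \<Lambda> + \<alpha>\<^sup>2) * (M p p + M e e)"
    using np ne cross by (simp add: algebra_simps)
  also have "M p p + M e e = M x x"
    using e_orth[OF pV] M_sym[of p e]
    by (simp add: x_eq bounded_bilinear.add_left[OF M] bounded_bilinear.add_right[OF M])
  also have "(1 / \<Lambda> + \<alpha>\<^sup>2) * M x x \<le> (1 / \<Lambda> + \<alpha>\<^sup>2) * (lamW k * n x x)"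
    using Mx \<Lambda> by (intro mult_left_mono) auto
  \<comment> \<open>The factor 1 is written out so that the positive \<open>n x x\<close> can be
    cancelled on the right.\<close>
  finally have "1 * n x x \<le> ((1 / \<Lambda> + \<alpha>\<^sup>2) * lamW k) * n x x" by simp
  then have "1 \<le> (1 / \<Lambda> + \<alpha>\<^sup>2) * lamW k"
    using nx_pos by (simp only: mult_le_cancel_right_pos)
  moreover have "1 / \<Lambda> + \<alpha>\<^sup>2 = (1 + \<alpha>\<^sup>2 * \<Lambda>) / \<Lambda>" using \<Lambda> by (simp add: field_simps)
  moreover have "0 < 1 + \<alpha>\<^sup>2 * \<Lambda>" using \<Lambda> by (simp add: add_pos_nonneg)
  ultimately show "lamV k / (1 + \<alpha>\<^sup>2 * lamV k) \<le> lamW k"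
    using \<Lambda> unfolding \<Lambda>_def[symmetric] by (simp add: field_simps)
qed

end
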